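(* Let $K$ be a field, $S=K[x_1,\ldots,x_n]$, and let $\mathbf d: 1=d_0\mid d_1\mid\cdots\mid d_s$ be a $\mathbf d$-sequence. Let $1\leq i_1<i_2<\cdots<i_r=n$ and let $\alpha_1,\ldots,\alpha_r$ be positive integers with $\mathbf d$-decompositions $\alpha_q=\sum_{t=0}^s\alpha_{qt}d_t$. If $u=x_{i_1}^{\alpha_1}x_{i_2}^{\alpha_2}\cdots x_{i_r}^{\alpha_r}$, then $$\langle u\rangle_{\mathbf d}=\langle x_{i_1}^{\alpha_1}\rangle_{\mathbf d}\cdot\langle x_{i_2}^{\alpha_2}\rangle_{\mathbf d}\cdots\langle x_{i_r}^{\alpha_r}\rangle_{\mathbf d}=\prod_{q=1}^{r}\prod_{t=0}^{s}(\mathbf m_q^{[d_t]})^{\alpha_{qt}},$$ where $\mathbf m_q=\{x_1,\ldots,x_{i_q}\}$ and $\mathbf m_q^{[d_t]}=\{x_1^{d_t},\ldots,x_{i_q}^{d_t}\}$.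
   Context: A $\mathbf d$-sequence is a strictly increasing sequence of positive integers $1=d_0\mid d_1\mid\cdots\mid d_s$, each dividing the next. Every $a\in\mathbb N$ has a unique $\mathbf d$-decomposition $a=\sum_{t=0}^s a_td_t$ with integers $a_t\geq 0$ and $a_t<d_{t+1}/d_t$ for $0\leq t<s$. For $a=\sum a_td_t$ and $b=\sum b_td_t$ ($\mathbf d$-decompositions) write $a\leq_{\mathbf d}b$ if $a_t\leq b_t$ for all $t$. For a monomial $v$, $\nu_i(v)$ is the exponent of $x_i$ in $v$. A monomial ideal $I\subset S$ is $\mathbf d$-fixed if for every monomial $v\in I$, all $1\leq j<i\leq n$ and every $t\leq_{\mathbf d}\nu_i(v)$, one has $v\,x_j^t/x_i^t\in I$. $\langle u\rangle_{\mathbf d}$ denotes the smallest $\mathbf d$-fixed ideal of $S$ containing the monomial $u$. In products and powers, a set of monomials stands for the ideal of $S$ it generates. *)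

theory Defs
  imports "HOL-Algebra.Ideal_Product" "HOL-Library.Poly_Mapping"
begin

section \<open>\<open>d\<close>-sequences and \<open>d\<close>-decompositions\<close>

text \<open>Only \<open>d 0, \<dots>, d s\<close> are relevant; positivity follows from \<open>d 0 = 1\<close> and monotonicity.\<close>

definition d_sequence :: "(nat \<Rightarrow> nat) \<Rightarrow> nat \<Rightarrow> bool" where
  "d_sequence d s \<longleftrightarrow> d 0 = 1 \<and> (\<forall>t<s. d t < d (Suc t) \<and> d t dvd d (Suc t))"

text \<open>The last digit \<open>c s\<close> is unbounded.\<close>

definition d_decomposition :: "(nat \<Rightarrow> nat) \<Rightarrow> nat \<Rightarrow> nat \<Rightarrow> (nat \<Rightarrow> nat) \<Rightarrow> bool" where
  "d_decomposition d s a c \<longleftrightarrow> a = (\<Sum>t\<le>s. c t * d t) \<and> (\<forall>t<s. c t < d (Suc t) div d t)"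

lemma d_sequence_mono: "d_sequence d (Suc s) \<Longrightarrow> d_sequence d s"
  by (simp add: d_sequence_def)

lemma d_sequence_pos: "d_sequence d s \<Longrightarrow> t \<le> s \<Longrightarrow> 0 < d t"
proof (cases t)
  case (Suc k)
  then show "d_sequence d s \<Longrightarrow> t \<le> s \<Longrightarrow> 0 < d t"
    by (metis Suc_le_eq d_sequence_def gr0I less_nat_zero_code)
qed (simp add: d_sequence_def)

lemma d_digits_less:
  assumes "d_sequence d s" "\<forall>t<s. c t < d (Suc t) div d t"
  shows "(\<Sum>t<s. c t * d t) < d s"
  using assms
proof (induction s)
  case 0
  then show ?case by (simp add: d_sequence_def)
next
  case (Suc s)
  have "(\<Sum>t<s. c t * d t) < d s"
    using Suc d_sequence_mono by simp
  then have "(\<Sum>t<Suc s. c t * d t) < Suc (c s) * d s" by simp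
  also have "\<dots> \<le> (d (Suc s) div d s) * d s"
    using Suc.prems(2) by (intro mult_right_mono) (auto simp: Suc_le_eq)
  also have "\<dots> = d (Suc s)"
    using Suc.prems(1) by (simp add: d_sequence_def)
  finally show ?case .
qed

lemma d_digits_unique:
  assumes "d_sequence d s" "\<forall>t<s. f t < d (Suc t) div d t" "\<forall>t<s. g t < d (Suc t) div d t"
    and "(\<Sum>t<s. f t * d t) + x * d s = (\<Sum>t<s. g t * d t) + y * d s"
  shows "x = y \<and> (\<forall>t<s. f t = g t)"
  using assms
proof (induction s arbitrary: x y)
  case 0
  then show ?case by (simp add: d_sequence_def)
next
  case (Suc s)
  let ?F = "\<Sum>t<Suc s. f t * d t" and ?G = "\<Sum>t<Suc s. g t * d t"
  have "?F < d (Suc s)" "?G < d (Suc s)"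
    using Suc.prems d_digits_less[of d "Suc s"] by blast+
  then have "x = (?F + x * d (Suc s)) div d (Suc s)" "y = (?G + y * d (Suc s)) div d (Suc s)"
    by (auto simp del: sum.lessThan_Suc)
  then have xy: "x = y" using Suc.prems(4) by metis
  then have "?F = ?G" using Suc.prems(4) by simp
  then have "f s = g s \<and> (\<forall>t<s. f t = g t)"
    using Suc.prems d_sequence_mono by (intro Suc.IH) auto
  with xy show ?case by (auto simp: less_Suc_eq)
qed

lemma d_decomposition_exists:
  assumes "d_sequence d s"
  shows "\<exists>c. d_decomposition d s a c"
proof -
  let ?c = "\<lambda>t. if t < s then (a mod d (Suc t)) div d t else a div d t"
  have mod: "(\<Sum>t<k. (a mod d (Suc t)) div d t * d t) = a mod d k" if "k \<le> s" for k
    using that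
  proof (induction k)
    case 0
    then show ?case using assms by (simp add: d_sequence_def)
  next
    case (Suc k)
    then have "a mod d k = (a mod d (Suc k)) mod d k"
      using assms by (simp add: d_sequence_def mod_mod_cancel)
    with Suc show ?case by simp
  qed
  have "{..s} = insert s {..<s}" by auto
  then have "(\<Sum>t\<le>s. ?c t * d t) = a"
    using mod[of s] by (simp add: add.commute)
  moreover have "?c t < d (Suc t) div d t" if "t < s" for t
  proof -
    have "0 < d (Suc t)" "d t dvd d (Suc t)"
      using that assms d_sequence_pos[of d s] by (auto simp: d_sequence_def)
    then show ?thesis
      using that by (simp add: less_mult_imp_div_less)
  qed
  ultimately have "d_decomposition d s a ?c" by (simp add: d_decomposition_def)
  then show ?thesis by blast
qed

lemma d_decomposition_unique:
  assumes "d_sequence d s" "d_decomposition d s a f" "d_decomposition d s a g" "t \<le> s"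
  shows "f t = g t"
proof -
  have "{..s} = insert s {..<s}" by auto
  then have "(\<Sum>t<s. f t * d t) + f s * d s = (\<Sum>t<s. g t * d t) + g s * d s"
    using assms by (simp add: d_decomposition_def add.commute)
  then show ?thesis
    using d_digits_unique[of d s f g "f s" "g s"] assms
    by (auto simp: d_decomposition_def le_less)
qed

text \<open>As decompositions exist and are unique on \<open>{..s}\<close>, it does not matter that they are
  quantified existentially here.\<close>

definition d_le :: "(nat \<Rightarrow> nat) \<Rightarrow> nat \<Rightarrow> nat \<Rightarrow> nat \<Rightarrow> bool" where
  "d_le d s a b \<longleftrightarrow>
     (\<exists>f g. d_decomposition d s a f \<and> d_decomposition d s b g \<and> (\<forall>t\<le>s. f t \<le> g t))"

lemma d_le_imp_le: "d_le d s a b \<Longrightarrow> a \<le> b"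
  by (auto simp: d_le_def d_decomposition_def intro!: sum_mono)

section \<open>The polynomial ring \<open>K[x\<^sub>1, \<dots>, x\<^sub>n]\<close>\<close>

text \<open>Polynomials are finitely supported maps from exponent vectors to coefficients; the
  ambient type has indeterminates indexed by all naturals, and only the indices \<open>1, \<dots>, n\<close>
  are allowed in the carrier.\<close>

type_synonym 'k poly = "(nat \<Rightarrow>\<^sub>0 nat) \<Rightarrow>\<^sub>0 'k"

definition poly_ring :: "nat \<Rightarrow> ('k::field) poly ring" where
  "poly_ring n = \<lparr>carrier = {p. \<forall>v\<in>Poly_Mapping.keys p. Poly_Mapping.keys v \<subseteq> {1..n}},
     mult = (*), one = 1, zero = 0, add = (+)\<rparr>"

definition indet :: "nat \<Rightarrow> ('k::field) poly" where
  "indet j = Poly_Mapping.single (Poly_Mapping.single j 1) 1"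

definition monomial :: "(nat \<Rightarrow>\<^sub>0 nat) \<Rightarrow> ('k::field) poly" where
  "monomial v = Poly_Mapping.single v 1"

lemma cring_poly_ring: "cring (poly_ring n :: ('k::field) poly ring)"
proof (rule cringI)
  let ?R = "poly_ring n :: 'k poly ring"
  have minus: "- p \<in> carrier ?R" if "p \<in> carrier ?R" for p
    using that by (auto simp: poly_ring_def)
  have plus: "p + q \<in> carrier ?R" if "p \<in> carrier ?R" "q \<in> carrier ?R" for p q
    using that Poly_Mapping.keys_add[of p q] by (fastforce simp: poly_ring_def)
  have times: "p * q \<in> carrier ?R" if "p \<in> carrier ?R" "q \<in> carrier ?R" for p q
  proof -
    have "Poly_Mapping.keys v \<subseteq> {1..n}" if v: "v \<in> Poly_Mapping.keys (p * q)" for v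
    proof -
      obtain a b where "a \<in> Poly_Mapping.keys p" "b \<in> Poly_Mapping.keys q" "v = a + b"
        using v Poly_Mapping.keys_mult[of p q] by blast
      then show ?thesis
        using \<open>p \<in> carrier ?R\<close> \<open>q \<in> carrier ?R\<close> Poly_Mapping.keys_add[of a b]
        by (fastforce simp: poly_ring_def)
    qed
    then show ?thesis by (simp add: poly_ring_def)
  qed
  have ops: "mult ?R = (*)" "add ?R = (+)" "one ?R = 1" "zero ?R = 0"
    and units: "1 \<in> carrier ?R" "0 \<in> carrier ?R"
    by (simp_all add: poly_ring_def)
  show "abelian_group ?R"
  proof (rule abelian_groupI)
    fix x assume "x \<in> carrier ?R"
    then show "\<exists>y\<in>carrier ?R. y \<oplus>\<^bsub>?R\<^esub> x = \<zero>\<^bsub>?R\<^esub>"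
      using minus[of x] by (intro bexI[of _ "- x"]) (simp_all add: ops)
  qed (simp_all add: ops units plus add_ac)
  show "Group.comm_monoid ?R"
    by (rule comm_monoidI) (simp_all add: ops units times mult_ac)
  show "(x \<oplus>\<^bsub>?R\<^esub> y) \<otimes>\<^bsub>?R\<^esub> z = x \<otimes>\<^bsub>?R\<^esub> z \<oplus>\<^bsub>?R\<^esub> y \<otimes>\<^bsub>?R\<^esub> z" for x y z
    by (simp add: ops distrib_right)
qed

section \<open>\<open>d\<close>-fixed ideals\<close>

definition monomial_ideal :: "nat \<Rightarrow> ('k::field) poly set \<Rightarrow> bool" where
  "monomial_ideal n I \<longleftrightarrow>
     (\<exists>V. monomial ` V \<subseteq> carrier (poly_ring n :: 'k poly ring) \<and> I = Idl\<^bsub>poly_ring n\<^esub> (monomial ` V))"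

text \<open>The monomial \<open>v x\<^sub>j\<^sup>t / x\<^sub>i\<^sup>t\<close> is written through exponent vectors; the subtraction does
  not truncate since \<open>d_le d s t (lookup v i)\<close> implies \<open>t \<le> lookup v i\<close>.\<close>

definition d_fixed :: "nat \<Rightarrow> (nat \<Rightarrow> nat) \<Rightarrow> nat \<Rightarrow> ('k::field) poly set \<Rightarrow> bool" where
  "d_fixed n d s I \<longleftrightarrow> monomial_ideal n I \<and>
     (\<forall>v i j t. monomial v \<in> I \<and> 1 \<le> j \<and> j < i \<and> i \<le> n \<and> d_le d s t (Poly_Mapping.lookup v i)
        \<longrightarrow> monomial (v - Poly_Mapping.single i t + Poly_Mapping.single j t) \<in> I)"

definition d_fixed_closure ::
    "nat \<Rightarrow> (nat \<Rightarrow> nat) \<Rightarrow> nat \<Rightarrow> ('k::field) poly \<Rightarrow> 'k poly set" where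
  "d_fixed_closure n d s u = (LEAST I. d_fixed n d s I \<and> u \<in> I)"

lemma d_fixed_carrier: "d_fixed n d s (carrier (poly_ring n :: ('k::field) poly ring))"
proof -
  let ?R = "poly_ring n :: 'k poly ring"
  interpret R: cring ?R by (rule cring_poly_ring)
  have 1: "monomial ` {0} = {\<one>\<^bsub>?R\<^esub>}"
    by (simp add: monomial_def poly_ring_def)
  have "monomial_ideal n (carrier ?R)"
    unfolding monomial_ideal_def
    by (rule exI[of _ "{0}"], unfold 1) (use R.genideal_one in auto)
  moreover have "Poly_Mapping.keys (v - Poly_Mapping.single i t + Poly_Mapping.single j t) \<subseteq> {1..n}"
    if "Poly_Mapping.keys v \<subseteq> {1..n}" "1 \<le> j" "j < i" "i \<le> n" for v :: "nat \<Rightarrow>\<^sub>0 nat" and i j t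
  proof -
    have "Poly_Mapping.keys (v - Poly_Mapping.single i t) \<subseteq> Poly_Mapping.keys v"
      by (auto simp: in_keys_iff lookup_minus)
    moreover have "Poly_Mapping.keys (Poly_Mapping.single j t) \<subseteq> {1..n}"
      using that by auto
    ultimately show ?thesis
      using that(1) Poly_Mapping.keys_add[of "v - Poly_Mapping.single i t" "Poly_Mapping.single j t"]
      by blast
  qed
  ultimately show ?thesis
    by (auto simp: d_fixed_def poly_ring_def monomial_def)
qed

lemma monomial_ideal_iff:
  "monomial_ideal n (I :: ('k::field) poly set) \<longleftrightarrow>
     ideal I (poly_ring n) \<and> (\<forall>p\<in>I. \<forall>v\<in>Poly_Mapping.keys p. monomial v \<in> I)"
proof -
  let ?R = "poly_ring n :: 'k poly ring"
  interpret R: cring ?R by (rule cring_poly_ring)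
  show ?thesis
  proof (intro iffI conjI)
    assume "monomial_ideal n I"
    then obtain V where V: "monomial ` V \<subseteq> carrier ?R" "I = Idl\<^bsub>?R\<^esub> (monomial ` V)"
      unfolding monomial_ideal_def by blast
    then show I: "ideal I ?R" by (simp add: R.genideal_ideal)
    interpret I: ideal I ?R by (rule I)
    define J where "J = {p \<in> I. \<forall>v\<in>Poly_Mapping.keys p. monomial v \<in> I}"
    have Jmult: "q * p \<in> J" if p: "p \<in> J" and q: "q \<in> carrier ?R" for p q
    proof -
      have "monomial v \<in> I" if v: "v \<in> Poly_Mapping.keys (q * p)" for v
      proof -
        obtain a b where ab: "a \<in> Poly_Mapping.keys q" "b \<in> Poly_Mapping.keys p" "v = a + b"
          using v Poly_Mapping.keys_mult[of q p] by blast
        have "monomial b \<in> I" "monomial a \<in> carrier ?R"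
          using ab p q by (auto simp: J_def poly_ring_def monomial_def)
        then have "monomial a \<otimes>\<^bsub>?R\<^esub> monomial b \<in> I"
          by (rule I.I_l_closed)
        then show ?thesis
          using ab by (simp add: poly_ring_def monomial_def mult_single)
      qed
      moreover have "q * p \<in> I"
        using p q I.I_l_closed[of p q] by (simp add: J_def poly_ring_def)
      ultimately show ?thesis by (simp add: J_def)
    qed
    have "ideal J ?R"
    proof (rule idealI[OF R.ring_axioms])
      show "subgroup J (add_monoid ?R)"
      proof (rule group.subgroupI[OF R.a_group])
        show "J \<subseteq> carrier (add_monoid ?R)" using I.a_subset by (auto simp: J_def)
        have "0 \<in> J" using I.zero_closed by (simp add: J_def poly_ring_def)
        then show "J \<noteq> {}" by blast
      next
        fix p assume p: "p \<in> J"
        have "- 1 \<in> carrier ?R" by (simp add: poly_ring_def)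
        from Jmult[OF p this] have mp: "- p \<in> J" by simp
        have "p \<in> carrier ?R" "- p \<in> carrier ?R"
          using p mp I.a_subset by (auto simp: J_def)
        then have "\<ominus>\<^bsub>?R\<^esub> p = - p"
          by (intro R.minus_equality) (auto simp: poly_ring_def)
        with mp show "inv\<^bsub>add_monoid ?R\<^esub> p \<in> J" by (simp add: a_inv_def)
      next
        fix p q assume "p \<in> J" "q \<in> J"
        then show "p \<otimes>\<^bsub>add_monoid ?R\<^esub> q \<in> J"
          using I.a_closed[of p q] Poly_Mapping.keys_add[of p q]
          by (fastforce simp: J_def poly_ring_def)
      qed
    next
      fix p q assume "p \<in> J" "q \<in> carrier ?R"
      from Jmult[OF this] show "q \<otimes>\<^bsub>?R\<^esub> p \<in> J" "p \<otimes>\<^bsub>?R\<^esub> q \<in> J"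
        by (simp_all add: poly_ring_def mult.commute)
    qed
    moreover have "monomial ` V \<subseteq> J"
      using R.genideal_self[OF V(1)] unfolding J_def V(2)[symmetric]
      by (auto simp: monomial_def split: if_splits)
    ultimately have "I \<subseteq> J" unfolding V(2) by (rule R.genideal_minimal)
    then show "\<forall>p\<in>I. \<forall>v\<in>Poly_Mapping.keys p. monomial v \<in> I"
      by (auto simp: J_def)
  next
    assume "ideal I ?R \<and> (\<forall>p\<in>I. \<forall>v\<in>Poly_Mapping.keys p. monomial v \<in> I)"
    then have I: "ideal I ?R" and keys: "\<And>p v. p \<in> I \<Longrightarrow> v \<in> Poly_Mapping.keys p \<Longrightarrow> monomial v \<in> I"
      by auto
    interpret I: ideal I ?R by (rule I)
    define V where "V = {v. monomial v \<in> I}"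
    have V: "monomial ` V \<subseteq> I" by (auto simp: V_def)
    then have Vc: "monomial ` V \<subseteq> carrier ?R" using I.a_subset by blast
    define G where "G = Idl\<^bsub>?R\<^esub> (monomial ` V)"
    interpret G: ideal G ?R unfolding G_def by (rule R.genideal_ideal[OF Vc])
    have "p \<in> G" if p: "p \<in> I" for p
    proof -
      have tm: "Poly_Mapping.single v (Poly_Mapping.lookup p v) \<in> G" if "v \<in> Poly_Mapping.keys p" for v
      proof -
        have "monomial v \<in> G"
          using keys[OF p that] R.genideal_self[OF Vc] by (auto simp: G_def V_def)
        moreover have "Poly_Mapping.single 0 (Poly_Mapping.lookup p v) \<in> carrier ?R"
          by (simp add: poly_ring_def)
        ultimately have "Poly_Mapping.single 0 (Poly_Mapping.lookup p v) \<otimes>\<^bsub>?R\<^esub> monomial v \<in> G"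
          by (rule G.I_l_closed)
        then show ?thesis by (simp add: poly_ring_def monomial_def mult_single)
      qed
      have "(\<Sum>v\<in>A. Poly_Mapping.single v (Poly_Mapping.lookup p v)) \<in> G"
        if "finite A" "A \<subseteq> Poly_Mapping.keys p" for A
        using that
      proof (induction A)
        case empty
        then show ?case using G.zero_closed by (simp add: poly_ring_def)
      next
        case (insert v A)
        then show ?case
          using G.a_closed[OF tm[of v]] by (simp add: poly_ring_def)
      qed
      from this[of "Poly_Mapping.keys p"]
      have "(\<Sum>v\<in>Poly_Mapping.keys p. Poly_Mapping.single v (Poly_Mapping.lookup p v)) \<in> G"
        by simp
      moreover have "(\<Sum>v\<in>Poly_Mapping.keys p. Poly_Mapping.single v (Poly_Mapping.lookup p v)) = p"
        by (rule poly_mapping_eqI) (auto simp: lookup_sum lookup_single when_def in_keys_iff)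
      ultimately show ?thesis by simp
    qed
    moreover have "G \<subseteq> I" unfolding G_def by (rule R.genideal_minimal[OF I V])
    ultimately have "I = G" by blast
    with Vc show "monomial_ideal n I" unfolding monomial_ideal_def G_def by blast
  qed
qed

text \<open>The least element in the definition of \<^const>\<open>d_fixed_closure\<close> exists.\<close>

lemma d_fixed_closure_least:
  fixes u :: "('k::field) poly"
  assumes u: "u \<in> carrier (poly_ring n)"
  shows "d_fixed n d s (d_fixed_closure n d s u)" and "u \<in> d_fixed_closure n d s u"
    and "\<And>I. d_fixed n d s I \<Longrightarrow> u \<in> I \<Longrightarrow> d_fixed_closure n d s u \<subseteq> I"
proof -
  let ?R = "poly_ring n :: 'k poly ring"
  interpret R: cring ?R by (rule cring_poly_ring)
  define \<I> where "\<I> = {I. d_fixed n d s I \<and> u \<in> I}"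
  have ne: "\<I> \<noteq> {}" using d_fixed_carrier u by (auto simp: \<I>_def)
  have "ideal (\<Inter>\<I>) ?R"
    by (rule R.i_Intersect[OF _ ne]) (simp add: \<I>_def d_fixed_def monomial_ideal_iff)
  then have "d_fixed n d s (\<Inter>\<I>)"
    by (auto simp: d_fixed_def monomial_ideal_iff \<I>_def)
  moreover have eq: "d_fixed_closure n d s u = \<Inter>\<I>"
    unfolding d_fixed_closure_def
    by (rule Least_equality) (use calculation in \<open>auto simp: \<I>_def\<close>)
  ultimately show "d_fixed n d s (d_fixed_closure n d s u)" "u \<in> d_fixed_closure n d s u"
    "\<And>I. d_fixed n d s I \<Longrightarrow> u \<in> I \<Longrightarrow> d_fixed_closure n d s u \<subseteq> I"
    by (auto simp: \<I>_def)
qed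

text \<open>The ideal of \<open>K[x\<^sub>1, \<dots>, x\<^sub>n]\<close> generated by \<open>x\<^sub>1\<^sup>e, \<dots>, x\<^sub>m\<^sup>e\<close>.\<close>

definition frob_power_ideal :: "nat \<Rightarrow> nat \<Rightarrow> nat \<Rightarrow> ('k::field) poly set" where
  "frob_power_ideal n m e = Idl\<^bsub>poly_ring n\<^esub> ((\<lambda>j. indet j ^ e) ` {1..m})"

end

theory Submission
  imports Defs "HOL-Library.Set_Algebras"
begin

text \<open>Write \<open>m\<^sub>q\<close> for the set of variables up to \<open>x\<^sub>i\<^sub>q\<close>. Both sides of the formula are monomial ideals,
  and the right-hand side has a combinatorial description. Pay the exponent of \<open>x\<^sub>i\<^sub>q\<close> in \<open>u\<close> by a pile
  of coins at position \<open>i\<^sub>q\<close> whose values are members of the \<open>d\<close>-sequence, as many of value \<open>d\<^sub>t\<close> as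
  the digit \<open>\<alpha>\<^sub>q\<^sub>t\<close> says. A
  generator of the product of the powers of the ideals \<open>m\<^sub>q\<^sup>[\<^sup>d\<^sup>t\<^sup>]\<close> arises by moving each coin of pile
  \<open>q\<close> to some position from \<open>1\<close> to \<open>i\<^sub>q\<close> and reading off the total value at each position.

  This product ideal contains \<open>u\<close>, where no coin is moved, and it is \<open>d\<close>-fixed: if \<open>t \<le>\<^sub>d \<nu>\<^sub>i(v)\<close>, then
  \<open>t\<close> and \<open>\<nu>\<^sub>i(v) - t\<close> add up without carries (\<open>d_le_no_carry\<close>), so the coins lying at \<open>i\<close> can be
  packed into two bins of these capacities, by placing the largest coins first (\<open>split_coins\<close>);
  the coins of the first bin move along with \<open>x\<^sub>i\<^sup>t\<close> (\<open>d_fixed_placements\<close>). Conversely, a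
  \<open>d\<close>-fixed ideal containing \<open>u\<close> contains every generator, since the coins can be moved to their
  targets one by one, pile by pile in increasing order of the positions of the piles. The coins
  then present at the position of the current pile are exactly those of this pile not yet moved
  away, so that their numbers are digits and the value of any one of them is \<open>\<le>\<^sub>d\<close> the exponent
  (\<open>d_fixed_mem_placements\<close>).

  Hence the closure of \<open>u\<close> is the product ideal (\<open>d_fixed_closure_prod\<close>). The same result for a
  single pile identifies the closures of the factors of \<open>u\<close>, which gives both equalities.\<close>

section \<open>Arithmetic of \<open>d\<close>-decompositions\<close>

lemma d_sequence_le:
  assumes "d_sequence d s" "k \<le> s"
  shows "d_sequence d k"
  using assms by (auto simp: d_sequence_def)

lemma d_sequence_dvd:
  assumes "d_sequence d s" "k \<le> t" "t \<le> s"
  shows "d k dvd d t"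
  using assms(2,3)
proof (induction t rule: dec_induct)
  case (step t)
  then show ?case using assms(1) by (auto simp: d_sequence_def intro: dvd_trans)
qed simp

lemma d_decomposition_mod:
  assumes d: "d_sequence d s" and c: "d_decomposition d s a c" and k: "k \<le> s"
  shows "a mod d k = (\<Sum>t<k. c t * d t)"
proof -
  have "{..s} = {..<k} \<union> {k..s}" "{..<k} \<inter> {k..s} = {}" using k by auto
  then have "a = (\<Sum>t<k. c t * d t) + (\<Sum>t=k..s. c t * d t)"
    using c by (simp add: d_decomposition_def sum.union_disjoint)
  moreover have "d k dvd (\<Sum>t=k..s. c t * d t)"
    using d_sequence_dvd[OF d] by (intro dvd_sum) auto
  moreover have "(\<Sum>t<k. c t * d t) < d k"
    using c k by (intro d_digits_less d_sequence_le[OF d]) (auto simp: d_decomposition_def)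
  ultimately show ?thesis by (auto simp: mod_add_right_eq elim!: dvdE)
qed

text \<open>If \<open>a \<le>\<^sub>d w\<close>, then adding \<open>a\<close> and \<open>w - a\<close> produces no carry at any position.\<close>

lemma d_le_no_carry:
  assumes d: "d_sequence d s" and le: "d_le d s a w" and k: "k \<le> s"
  shows "a mod d k + (w - a) mod d k < d k"
proof -
  obtain f g where f: "d_decomposition d s a f" and g: "d_decomposition d s w g"
    and fg: "\<And>t. t \<le> s \<Longrightarrow> f t \<le> g t"
    using le by (auto simp: d_le_def)
  have "w - a = (\<Sum>t\<le>s. (g t - f t) * d t)"
    using f g fg sum_subtractf_nat[of "{..s}" "\<lambda>t. f t * d t" "\<lambda>t. g t * d t"]
    by (simp add: d_decomposition_def diff_mult_distrib)
  moreover have "g t - f t < d (Suc t) div d t" if "t < s" for t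
    using g that by (auto simp: d_decomposition_def intro: le_less_trans[OF diff_le_self])
  ultimately have h: "d_decomposition d s (w - a) (\<lambda>t. g t - f t)"
    by (simp add: d_decomposition_def)
  have "a mod d k + (w - a) mod d k = (\<Sum>t<k. f t * d t + (g t - f t) * d t)"
    using d_decomposition_mod[OF d f k] d_decomposition_mod[OF d h k]
    by (simp add: sum.distrib)
  also have "\<dots> = (\<Sum>t<k. g t * d t)"
    using fg k by (intro sum.cong) (simp_all flip: add_mult_distrib)
  also have "\<dots> < d k"
    using g k by (intro d_digits_less d_sequence_le[OF d]) (auto simp: d_decomposition_def)
  finally show ?thesis .
qed

text \<open>A packing lemma for coins whose values form a chain under divisibility: if the total value is at most
  \<open>A + B\<close> and the addition of \<open>A\<close> and \<open>B\<close> has no carry with respect to any of the values, the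
  coins can be distributed over two bins of capacities \<open>A\<close> and \<open>B\<close>. The largest coin always fits
  into one of the bins, and the no-carry condition is inherited by what remains.\<close>

lemma split_coins:
  fixes e :: "'x \<Rightarrow> nat"
  assumes "finite X"
    and "\<And>x y. x \<in> X \<Longrightarrow> y \<in> X \<Longrightarrow> e x \<le> e y \<Longrightarrow> e x dvd e y"
    and "\<And>x. x \<in> X \<Longrightarrow> A mod e x + B mod e x < e x"
    and "sum e X \<le> A + B"
  shows "\<exists>Y\<subseteq>X. sum e Y \<le> A \<and> sum e (X - Y) \<le> B"
  using assms
proof (induction X arbitrary: A B rule: finite_ranking_induct[where f = e])
  case empty
  then show ?case by simp
next
  case (insert x X)
  show ?case
  proof (cases "x \<in> X")
    case True
    then show ?thesis using insert by (simp add: insert_absorb)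
  next
    case x: False
    have dvd: "e y dvd e x" if "y \<in> X" for y
      using insert.prems(1) insert.hyps(2) that by auto
    have total: "e x + sum e X \<le> A + B"
      using insert.prems(3) insert.hyps(1) x by simp
    have mod: "(C - e x) mod e y = C mod e y" if "e x \<le> C" "y \<in> X" for C y
      using dvd[OF that(2)] that(1)
      by (metis add_diff_cancel_right' dvd_div_mult_self le_add_diff_inverse2 mod_mult_self1)
    show ?thesis
    proof (cases "e x \<le> A")
      case True
      have "\<exists>Y\<subseteq>X. sum e Y \<le> A - e x \<and> sum e (X - Y) \<le> B"
      proof (rule insert.IH)
        show "(A - e x) mod e y + B mod e y < e y" if "y \<in> X" for y
          using insert.prems(2)[of y] that mod[OF True that] by simp
      qed (use insert.prems(1) total True in auto)
      then obtain Y where Y: "Y \<subseteq> X" "sum e Y \<le> A - e x" "sum e (X - Y) \<le> B" by blast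
      moreover have "finite Y" "x \<notin> Y" "insert x X - insert x Y = X - Y"
        using Y x insert.hyps(1) by (auto intro: finite_subset)
      ultimately show ?thesis
        using True by (intro exI[of _ "insert x Y"]) auto
    next
      case A: False
      \<comment> \<open>If the largest coin also failed to fit into \<open>B\<close>, both capacities would be their own
        residues, with a sum below the value of that coin.\<close>
      have B: "e x \<le> B"
      proof (rule ccontr)
        assume "\<not> e x \<le> B"
        then have "A + B < e x" using A insert.prems(2)[of x] by simp
        then show False using total by simp
      qed
      have "\<exists>Y\<subseteq>X. sum e Y \<le> A \<and> sum e (X - Y) \<le> B - e x"
      proof (rule insert.IH)
        show "A mod e y + (B - e x) mod e y < e y" if "y \<in> X" for y
          using insert.prems(2)[of y] that mod[OF B that] by simp
      qed (use insert.prems(1) total B in auto)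
      then obtain Y where Y: "Y \<subseteq> X" "sum e Y \<le> A" "sum e (X - Y) \<le> B - e x" by blast
      moreover have "insert x X - Y = insert x (X - Y)" "finite (X - Y)" "x \<notin> X - Y"
        using Y x insert.hyps(1) by auto
      ultimately show ?thesis
        using B by (intro exI[of _ Y]) auto
    qed
  qed
qed

section \<open>Ideals generated by monomials\<close>

text \<open>The ideal generated by the monomials with exponent vectors in \<open>V\<close>. With the elementwise
  addition of sets of exponent vectors, products of such ideals become sums of generating
  sets.\<close>

definition mon_ideal :: "nat \<Rightarrow> (nat \<Rightarrow>\<^sub>0 nat) set \<Rightarrow> ('k::field) poly set" where
  "mon_ideal n V = Idl\<^bsub>poly_ring n\<^esub> (monomial ` V)"

text \<open>The exponent vectors of the monomials in \<open>x\<^sub>1, \<dots>, x\<^sub>n\<close>.\<close>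

definition exps_in :: "nat \<Rightarrow> (nat \<Rightarrow>\<^sub>0 nat) set" where
  "exps_in n = {v. Poly_Mapping.keys v \<subseteq> {1..n}}"

lemma monomial_carrier_iff:
  "(monomial v :: ('k::field) poly) \<in> carrier (poly_ring n) \<longleftrightarrow> v \<in> exps_in n"
  by (simp add: monomial_def poly_ring_def exps_in_def)

lemma monomial_image_carrier:
  "V \<subseteq> exps_in n \<Longrightarrow> monomial ` V \<subseteq> carrier (poly_ring n :: ('k::field) poly ring)"
  using monomial_carrier_iff by blast

lemma monomial_add: "monomial (v + w) = (monomial v * monomial w :: ('k::field) poly)"
  by (simp add: monomial_def mult_single)

lemma monomial_sum:
  "finite T \<Longrightarrow> monomial (\<Sum>x\<in>T. v x) = (\<Prod>x\<in>T. monomial (v x) :: ('k::field) poly)"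
  by (induction T rule: finite_induct) (simp_all add: monomial_add, simp add: monomial_def)

lemma indet_power: "indet j ^ e = (monomial (Poly_Mapping.single j e) :: ('k::field) poly)"
proof (induction e)
  case (Suc e)
  have "Poly_Mapping.single j (Suc e) = Poly_Mapping.single j 1 + Poly_Mapping.single j e"
    by (simp flip: single_add)
  with Suc show ?case
    by (simp add: monomial_add) (simp add: indet_def monomial_def)
qed (simp add: monomial_def)

lemma exps_in_add: "v \<in> exps_in n \<Longrightarrow> w \<in> exps_in n \<Longrightarrow> v + w \<in> exps_in n"
  using Poly_Mapping.keys_add[of v w] by (auto simp: exps_in_def)

lemma exps_in_summand: "v + w \<in> exps_in n \<Longrightarrow> w \<in> exps_in n"
  by (force simp: exps_in_def in_keys_iff lookup_add)

lemma exps_in_single: "j \<in> {1..n} \<Longrightarrow> Poly_Mapping.single j e \<in> exps_in n"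
  by (auto simp: exps_in_def)

lemma exps_in_set_sum:
  assumes "finite T" "\<And>x. x \<in> T \<Longrightarrow> V x \<subseteq> exps_in n"
  shows "(\<Sum>x\<in>T. V x) \<subseteq> exps_in n"
  using assms
  by (induction T rule: finite_induct)
    (auto simp: set_plus_def subset_eq intro!: exps_in_add, simp add: exps_in_def)

lemma mon_ideal_ideal:
  assumes "V \<subseteq> exps_in n"
  shows "ideal (mon_ideal n V :: ('k::field) poly set) (poly_ring n)"
proof -
  interpret R: cring "poly_ring n :: 'k poly ring" by (rule cring_poly_ring)
  show ?thesis
    unfolding mon_ideal_def by (rule R.genideal_ideal[OF monomial_image_carrier[OF assms]])
qed

lemma monomial_mem_mon_ideal:
  assumes V: "V \<subseteq> exps_in n" and w: "w \<in> V" and r: "w + r \<in> exps_in n"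
  shows "(monomial (w + r) :: ('k::field) poly) \<in> mon_ideal n V"
proof -
  let ?R = "poly_ring n :: 'k poly ring"
  interpret R: cring ?R by (rule cring_poly_ring)
  interpret I: ideal "mon_ideal n V" ?R by (rule mon_ideal_ideal[OF V])
  have "monomial w \<in> (mon_ideal n V :: 'k poly set)"
    unfolding mon_ideal_def using R.genideal_self[OF monomial_image_carrier[OF V]] w by blast
  moreover have "monomial r \<in> carrier ?R"
    using exps_in_summand[OF r] by (simp add: monomial_carrier_iff)
  ultimately have "monomial w \<otimes>\<^bsub>?R\<^esub> monomial r \<in> mon_ideal n V"
    by (rule I.I_r_closed)
  then show ?thesis by (simp add: monomial_add poly_ring_def)
qed

text \<open>A polynomial lies in a monomial ideal iff each of its exponent vectors is a multiple of a
  generator.\<close>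

lemma mon_ideal_eq:
  assumes V: "V \<subseteq> exps_in n"
  shows "mon_ideal n V = {p \<in> carrier (poly_ring n :: ('k::field) poly ring).
           \<forall>v\<in>Poly_Mapping.keys p. \<exists>w\<in>V. \<exists>r. v = w + r}" (is "_ = ?J")
proof
  let ?R = "poly_ring n :: 'k poly ring"
  interpret R: cring ?R by (rule cring_poly_ring)
  have mult: "q * p \<in> ?J" if p: "p \<in> ?J" and q: "q \<in> carrier ?R" for p q
  proof -
    have "q \<otimes>\<^bsub>?R\<^esub> p \<in> carrier ?R" using p q by (intro R.m_closed) auto
    moreover have "\<exists>w\<in>V. \<exists>r. v = w + r" if v: "v \<in> Poly_Mapping.keys (q * p)" for v
    proof -
      obtain a b where b: "b \<in> Poly_Mapping.keys p" "v = a + b"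
        using v Poly_Mapping.keys_mult[of q p] by blast
      then obtain w r where "w \<in> V" "b = w + r"
        using p by auto
      with b show ?thesis by (intro bexI[of _ w] exI[of _ "a + r"]) (simp_all add: ac_simps)
    qed
    ultimately show ?thesis by (simp add: poly_ring_def)
  qed
  have J: "ideal ?J ?R"
  proof (rule idealI[OF R.ring_axioms])
    show "subgroup ?J (add_monoid ?R)"
    proof (rule group.subgroupI[OF R.a_group])
      show "?J \<subseteq> carrier (add_monoid ?R)" by auto
      have "0 \<in> ?J" by (simp add: poly_ring_def)
      then show "?J \<noteq> {}" by blast
    next
      fix p assume p: "p \<in> ?J"
      have mp: "- p \<in> ?J" using mult[OF p, of "- 1"] by (simp add: poly_ring_def)
      have "\<ominus>\<^bsub>?R\<^esub> p = - p"
        using p mp by (intro R.minus_equality) (auto simp: poly_ring_def)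
      with mp show "inv\<^bsub>add_monoid ?R\<^esub> p \<in> ?J" by (simp add: a_inv_def)
    next
      fix p q assume pq: "p \<in> ?J" "q \<in> ?J"
      then have "p \<oplus>\<^bsub>?R\<^esub> q \<in> carrier ?R" by (intro R.a_closed) auto
      moreover have "\<exists>w\<in>V. \<exists>r. v = w + r" if "v \<in> Poly_Mapping.keys (p + q)" for v
        using that pq Poly_Mapping.keys_add[of p q] by blast
      ultimately show "p \<otimes>\<^bsub>add_monoid ?R\<^esub> q \<in> ?J" by (simp add: poly_ring_def)
    qed
  next
    fix p q assume "p \<in> ?J" "q \<in> carrier ?R"
    from mult[OF this] show "q \<otimes>\<^bsub>?R\<^esub> p \<in> ?J" "p \<otimes>\<^bsub>?R\<^esub> q \<in> ?J"
      by (simp_all add: poly_ring_def mult.commute)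
  qed
  have "monomial ` V \<subseteq> ?J"
  proof
    fix p :: "'k poly" assume "p \<in> monomial ` V"
    then obtain w where w: "w \<in> V" "p = monomial w" by blast
    then have "p \<in> carrier ?R" using V by (auto simp: monomial_carrier_iff)
    moreover have "Poly_Mapping.keys p = {w}" by (simp add: w monomial_def)
    moreover have "\<exists>w'\<in>V. \<exists>r. w = w' + r"
      using w(1) by (intro bexI[of _ w] exI[of _ 0]) simp_all
    ultimately show "p \<in> ?J" by simp
  qed
  then show "mon_ideal n V \<subseteq> ?J"
    unfolding mon_ideal_def by (rule R.genideal_minimal[OF J])
  have mono: "monomial v \<in> (mon_ideal n V :: 'k poly set)" if "monomial v \<in> ?J" for v
  proof -
    have v: "v \<in> exps_in n" using that by (simp add: monomial_carrier_iff)
    have "Poly_Mapping.keys (monomial v :: 'k poly) = {v}" by (simp add: monomial_def)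
    then have "\<exists>w\<in>V. \<exists>r. v = w + r" using that by simp
    then obtain w r where w: "w \<in> V" "v = w + r" by blast
    show ?thesis using v unfolding w(2) by (rule monomial_mem_mon_ideal[OF V w(1)])
  qed
  have "monomial_ideal n ?J"
    unfolding monomial_ideal_iff using J by (auto simp: monomial_def poly_ring_def)
  then obtain U where U: "monomial ` U \<subseteq> carrier ?R" "?J = Idl\<^bsub>?R\<^esub> (monomial ` U)"
    unfolding monomial_ideal_def by blast
  have "monomial ` U \<subseteq> ?J"
    unfolding U(2) by (rule R.genideal_self[OF U(1)])
  then have "monomial ` U \<subseteq> (mon_ideal n V :: 'k poly set)"
    using mono by blast
  then show "?J \<subseteq> mon_ideal n V"
    unfolding U(2) by (rule R.genideal_minimal[OF mon_ideal_ideal[OF V]])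
qed

lemma monomial_mem_mon_ideal_iff:
  assumes "V \<subseteq> exps_in n"
  shows "(monomial v :: ('k::field) poly) \<in> mon_ideal n V \<longleftrightarrow>
           v \<in> exps_in n \<and> (\<exists>w\<in>V. \<exists>r. v = w + r)"
  by (simp add: mon_ideal_eq[OF assms] monomial_carrier_iff) (simp add: monomial_def)

lemma monomial_ideal_mon_ideal:
  "V \<subseteq> exps_in n \<Longrightarrow> monomial_ideal n (mon_ideal n V :: ('k::field) poly set)"
  unfolding monomial_ideal_def mon_ideal_def using monomial_image_carrier by blast

lemma mon_ideal_mult:
  assumes V: "V \<subseteq> exps_in n" and W: "W \<subseteq> exps_in n"
  shows "ideal_prod (poly_ring n) (mon_ideal n V) (mon_ideal n W)
           = (mon_ideal n (V + W) :: ('k::field) poly set)"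
proof
  let ?R = "poly_ring n :: 'k poly ring"
  interpret R: cring ?R by (rule cring_poly_ring)
  have VW: "V + W \<subseteq> exps_in n"
    using V W by (auto elim!: set_plus_elim intro!: exps_in_add)
  have "x \<otimes>\<^bsub>?R\<^esub> y \<in> mon_ideal n (V + W)"
    if x: "x \<in> mon_ideal n V" and y: "y \<in> mon_ideal n W" for x y
  proof -
    have "x \<otimes>\<^bsub>?R\<^esub> y \<in> carrier ?R"
      using x y by (intro R.m_closed) (auto simp: mon_ideal_eq V W)
    moreover have "\<exists>w\<in>V + W. \<exists>r. v = w + r" if v: "v \<in> Poly_Mapping.keys (x * y)" for v
    proof -
      obtain a b where ab: "a \<in> Poly_Mapping.keys x" "b \<in> Poly_Mapping.keys y" "v = a + b"
        using v Poly_Mapping.keys_mult[of x y] by blast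
      obtain w1 r1 where "w1 \<in> V" "a = w1 + r1"
        using x ab(1) by (auto simp: mon_ideal_eq[OF V])
      moreover obtain w2 r2 where "w2 \<in> W" "b = w2 + r2"
        using y ab(2) by (auto simp: mon_ideal_eq[OF W])
      ultimately have "w1 \<in> V" "w2 \<in> W" "v = (w1 + r1) + (w2 + r2)"
        using ab(3) by simp_all
      then show ?thesis
        by (intro bexI[of _ "w1 + w2"] exI[of _ "r1 + r2"]) (auto simp: ac_simps)
    qed
    ultimately show ?thesis by (simp add: mon_ideal_eq[OF VW] poly_ring_def)
  qed
  then have "set_mult ?R (mon_ideal n V) (mon_ideal n W) \<subseteq> mon_ideal n (V + W)"
    by (auto simp: set_mult_def)
  then show "ideal_prod ?R (mon_ideal n V) (mon_ideal n W) \<subseteq> mon_ideal n (V + W)"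
    unfolding R.ideal_prod_eq_genideal[OF mon_ideal_ideal[OF V] mon_ideal_ideal[OF W]]
    by (rule R.genideal_minimal[OF mon_ideal_ideal[OF VW]])
  have "monomial ` (V + W) \<subseteq> ideal_prod ?R (mon_ideal n V) (mon_ideal n W)"
  proof
    fix p :: "'k poly" assume "p \<in> monomial ` (V + W)"
    then obtain v w where vw: "v \<in> V" "w \<in> W" "p = monomial v \<otimes>\<^bsub>?R\<^esub> monomial w"
      by (auto simp: set_plus_def monomial_add poly_ring_def)
    moreover have "monomial v \<in> (mon_ideal n V :: 'k poly set)"
      "monomial w \<in> (mon_ideal n W :: 'k poly set)"
      using monomial_mem_mon_ideal[OF V, of v 0] monomial_mem_mon_ideal[OF W, of w 0] vw V W
      by auto
    ultimately show "p \<in> ideal_prod ?R (mon_ideal n V) (mon_ideal n W)"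
      by (simp add: ideal_prod.prod)
  qed
  then show "mon_ideal n (V + W) \<subseteq> ideal_prod ?R (mon_ideal n V) (mon_ideal n W)"
    unfolding mon_ideal_def[of n "V + W"]
    by (rule R.genideal_minimal[OF
          R.ideal_prod_is_ideal[OF mon_ideal_ideal[OF V] mon_ideal_ideal[OF W]]])
qed

lemma mon_ideal_zero: "mon_ideal n {0} = carrier (poly_ring n :: ('k::field) poly ring)"
proof -
  have "{0} \<subseteq> exps_in n" by (simp add: exps_in_def)
  then show ?thesis by (auto simp: mon_ideal_eq)
qed

lemma mon_ideal_finprod:
  fixes V :: "'x \<Rightarrow> (nat \<Rightarrow>\<^sub>0 nat) set"
  assumes "finite T" "\<And>x. x \<in> T \<Longrightarrow> V x \<subseteq> exps_in n"
  shows "(\<Otimes>\<^bsub>ideals_set (poly_ring n)\<^esub> x\<in>T. mon_ideal n (V x))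
           = (mon_ideal n (\<Sum>x\<in>T. V x) :: ('k::field) poly set)"
  using assms
proof (induction T rule: finite_induct)
  let ?R = "poly_ring n :: 'k poly ring"
  interpret R: cring ?R by (rule cring_poly_ring)
  interpret M: comm_monoid "ideals_set ?R" by (rule R.ideals_set_is_comm_monoid)
  {
    case empty
    show ?case by (simp add: mon_ideal_zero) (simp add: ideals_set_def)
  next
    case (insert x T)
    have "(\<lambda>x. mon_ideal n (V x)) \<in> T \<rightarrow> carrier (ideals_set ?R)"
      "mon_ideal n (V x) \<in> carrier (ideals_set ?R)"
      using insert.prems by (auto simp: ideals_set_def intro!: mon_ideal_ideal)
    then show ?case
      using insert exps_in_set_sum[OF insert.hyps(1), of V n]
      by (simp add: mon_ideal_mult[symmetric]) (simp add: ideals_set_def)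
  }
qed

lemma mon_ideal_power:
  fixes k :: nat
  assumes "V \<subseteq> exps_in n"
  shows "mon_ideal n V [^]\<^bsub>ideals_set (poly_ring n)\<^esub> k
           = (mon_ideal n (\<Sum>j<k. V) :: ('k::field) poly set)"
proof -
  let ?R = "poly_ring n :: 'k poly ring"
  interpret R: cring ?R by (rule cring_poly_ring)
  interpret M: comm_monoid "ideals_set ?R" by (rule R.ideals_set_is_comm_monoid)
  have "mon_ideal n V \<in> carrier (ideals_set ?R)"
    using mon_ideal_ideal[OF assms] by (simp add: ideals_set_def)
  then have "(\<Otimes>\<^bsub>ideals_set ?R\<^esub> j\<in>{..<k}. mon_ideal n V)
      = mon_ideal n V [^]\<^bsub>ideals_set ?R\<^esub> card {..<k}"
    by (rule M.finprod_const)
  moreover have "(\<Otimes>\<^bsub>ideals_set ?R\<^esub> j\<in>{..<k}. mon_ideal n V) = mon_ideal n (\<Sum>j<k. V)"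
    using assms by (intro mon_ideal_finprod) auto
  ultimately show ?thesis by (simp only: card_lessThan)
qed

lemma frob_power_ideal_eq:
  "frob_power_ideal n m e
     = (mon_ideal n ((\<lambda>j. Poly_Mapping.single j e) ` {1..m}) :: ('k::field) poly set)"
  by (simp add: frob_power_ideal_def mon_ideal_def indet_power image_image)

lemma frob_power_ideal_product:
  fixes e c :: "nat \<Rightarrow> nat"
  assumes m: "m \<le> n" and T: "finite T"
  shows "(\<Otimes>\<^bsub>ideals_set (poly_ring n)\<^esub> t\<in>T. frob_power_ideal n m (e t) [^]\<^bsub>ideals_set (poly_ring n)\<^esub> c t)
           = (mon_ideal n (\<Sum>t\<in>T. \<Sum>k<c t. (\<lambda>j. Poly_Mapping.single j (e t)) ` {1..m}) :: ('k::field) poly set)"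
proof -
  define V where "V = (\<lambda>t. (\<lambda>j. Poly_Mapping.single j (e t)) ` {1..m})"
  have V: "V t \<subseteq> exps_in n" for t using m by (auto simp: V_def intro!: exps_in_single)
  have "frob_power_ideal n m (e t) [^]\<^bsub>ideals_set (poly_ring n)\<^esub> c t
      = (mon_ideal n (\<Sum>k<c t. V t) :: 'k poly set)" for t
    using mon_ideal_power[OF V] by (simp only: frob_power_ideal_eq V_def)
  moreover have "(\<Otimes>\<^bsub>ideals_set (poly_ring n)\<^esub> t\<in>T. mon_ideal n (\<Sum>k<c t. V t))
      = (mon_ideal n (\<Sum>t\<in>T. \<Sum>k<c t. V t) :: 'k poly set)"
    using V by (intro mon_ideal_finprod[OF T] exps_in_set_sum) auto
  ultimately show ?thesis by (simp only: V_def)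
qed

section \<open>Placements of coins\<close>

text \<open>A coin \<open>x\<close> of value \<open>e x\<close> placed at position \<open>f x\<close> stands for the power
  \<open>x\<^sub>k\<^sup>m\<close> with \<open>k = f x\<close> and \<open>m = e x\<close>; the exponent of a variable is the total value of the coins lying there. Each coin
  may be placed at any position from \<open>1\<close> to its bound \<open>b x\<close>.\<close>

definition coin_exp :: "'x set \<Rightarrow> ('x \<Rightarrow> nat) \<Rightarrow> ('x \<Rightarrow> nat) \<Rightarrow> (nat \<Rightarrow>\<^sub>0 nat)" where
  "coin_exp X e f = (\<Sum>x\<in>X. Poly_Mapping.single (f x) (e x))"

definition placements :: "'x set \<Rightarrow> ('x \<Rightarrow> nat) \<Rightarrow> ('x \<Rightarrow> nat) \<Rightarrow> (nat \<Rightarrow>\<^sub>0 nat) set" where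
  "placements X e b = (\<Sum>x\<in>X. (\<lambda>j. Poly_Mapping.single j (e x)) ` {1..b x})"

lemma placements_eq:
  assumes "finite X"
  shows "placements X e b = coin_exp X e ` {f. \<forall>x\<in>X. f x \<in> {1..b x}}"
proof
  show "placements X e b \<subseteq> coin_exp X e ` {f. \<forall>x\<in>X. f x \<in> {1..b x}}"
  proof
    fix v assume "v \<in> placements X e b"
    then obtain w where w: "v = sum w X"
      "\<forall>x\<in>X. w x \<in> (\<lambda>j. Poly_Mapping.single j (e x)) ` {1..b x}"
      unfolding placements_def set_sum_alt[OF assms] by blast
    then have "\<forall>x\<in>X. \<exists>j. j \<in> {1..b x} \<and> w x = Poly_Mapping.single j (e x)" by blast
    from bchoice[OF this] obtain f
      where f: "\<And>x. x \<in> X \<Longrightarrow> f x \<in> {1..b x} \<and> w x = Poly_Mapping.single (f x) (e x)"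
      by blast
    then have "v = coin_exp X e f" by (simp add: w coin_exp_def)
    with f show "v \<in> coin_exp X e ` {f. \<forall>x\<in>X. f x \<in> {1..b x}}" by blast
  qed
  show "coin_exp X e ` {f. \<forall>x\<in>X. f x \<in> {1..b x}} \<subseteq> placements X e b"
  proof
    fix v assume "v \<in> coin_exp X e ` {f. \<forall>x\<in>X. f x \<in> {1..b x}}"
    then obtain f where f: "\<forall>x\<in>X. f x \<in> {1..b x}" "v = coin_exp X e f" by blast
    then have "\<forall>x\<in>X. Poly_Mapping.single (f x) (e x)
        \<in> (\<lambda>j. Poly_Mapping.single j (e x)) ` {1..b x}"
      by blast
    then show "v \<in> placements X e b"
      unfolding placements_def set_sum_alt[OF assms] f(2) coin_exp_def by blast
  qed
qed

lemma lookup_coin_exp: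
  assumes "finite X"
  shows "Poly_Mapping.lookup (coin_exp X e f) k = sum e {x\<in>X. f x = k}"
  using assms
  by (simp add: coin_exp_def lookup_sum lookup_single when_def sum.If_cases Int_def conj_commute)

lemma placements_exps_in:
  assumes "finite X" "b ` X \<subseteq> {1..n}"
  shows "placements X e b \<subseteq> exps_in n"
  unfolding placements_def
  using assms by (intro exps_in_set_sum) (auto intro!: exps_in_single)

lemma le_imp_add:
  fixes v w :: "nat \<Rightarrow>\<^sub>0 nat"
  assumes "\<And>k. Poly_Mapping.lookup w k \<le> Poly_Mapping.lookup v k"
  shows "v = w + (v - w)"
  using assms by (intro poly_mapping_eqI) (simp add: lookup_add lookup_minus)

text \<open>If \<open>t \<le>\<^sub>d \<nu>\<^sub>i(v)\<close>, the coins can follow a replacement of \<open>x\<^sub>i\<^sup>t\<close> by \<open>x\<^sub>j\<^sup>t\<close> in \<open>v\<close>: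
  those lying at \<open>i\<close> are split into coins of total value at most \<open>t\<close>, which move to \<open>j\<close>, and
  coins that fit into what is left at \<open>i\<close>.\<close>

lemma d_fixed_placements:
  fixes lev b :: "'x \<Rightarrow> nat"
  assumes d: "d_sequence d s" and X: "finite X" and lev: "lev ` X \<subseteq> {..s}" and b: "b ` X \<subseteq> {1..n}"
  shows "d_fixed n d s (mon_ideal n (placements X (\<lambda>x. d (lev x)) b) :: ('k::field) poly set)"
proof -
  define e where "e = (\<lambda>x. d (lev x))"
  let ?V = "placements X e b"
  have V: "?V \<subseteq> exps_in n" by (rule placements_exps_in[OF X b])
  have move: "v - Poly_Mapping.single i t + Poly_Mapping.single j t \<in> exps_in n \<and>
      (\<exists>w\<in>?V. \<exists>r. v - Poly_Mapping.single i t + Poly_Mapping.single j t = w + r)"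
    (is "?v' \<in> _ \<and> _")
    if v: "v \<in> exps_in n" and w: "w \<in> ?V" "v = w + r" and ij: "1 \<le> j" "j < i" "i \<le> n"
      and t: "d_le d s t (Poly_Mapping.lookup v i)" for v w r i j t
  proof -
    obtain f where f: "\<And>x. x \<in> X \<Longrightarrow> f x \<in> {1..b x}" and wf: "w = coin_exp X e f"
      using w(1) unfolding placements_eq[OF X] by blast
    define C where "C = {x\<in>X. f x = i}"
    have tv: "t \<le> Poly_Mapping.lookup v i" using t by (rule d_le_imp_le)
    have "\<exists>Y\<subseteq>C. sum e Y \<le> t \<and> sum e (C - Y) \<le> Poly_Mapping.lookup v i - t"
    proof (rule split_coins)
      show "finite C" using X by (simp add: C_def)
      show "e x dvd e y" if "x \<in> C" "y \<in> C" "e x \<le> e y" for x y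
      proof (cases "lev x \<le> lev y")
        case True
        then show ?thesis
          using lev that by (auto simp: e_def C_def intro!: d_sequence_dvd[OF d])
      next
        case False
        then have "e y dvd e x"
          using lev that by (auto simp: e_def C_def intro!: d_sequence_dvd[OF d])
        moreover have "0 < e x"
          using lev that d_sequence_pos[OF d] by (auto simp: e_def C_def)
        ultimately show ?thesis using that(3) by (metis dvd_imp_le dvd_refl le_antisym)
      qed
      show "t mod e x + (Poly_Mapping.lookup v i - t) mod e x < e x" if "x \<in> C" for x
        using d_le_no_carry[OF d t] lev that by (auto simp: e_def C_def)
      have "sum e C \<le> Poly_Mapping.lookup v i"
        by (simp add: w(2) wf lookup_add lookup_coin_exp[OF X] C_def)
      then show "sum e C \<le> t + (Poly_Mapping.lookup v i - t)" using tv by simp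
    qed
    then obtain Y where Y: "Y \<subseteq> C" "sum e Y \<le> t" "sum e (C - Y) \<le> Poly_Mapping.lookup v i - t"
      by blast
    define f' where "f' = (\<lambda>x. if x \<in> Y then j else f x)"
    have "f' x \<in> {1..b x}" if "x \<in> X" for x
      using f[OF that] Y(1) ij by (auto simp: f'_def C_def)
    then have w': "coin_exp X e f' \<in> ?V" unfolding placements_eq[OF X] by blast
    have "Poly_Mapping.lookup (coin_exp X e f') k \<le> Poly_Mapping.lookup ?v' k" for k
    proof -
      have rest: "sum e {x\<in>X. f x = k} \<le> Poly_Mapping.lookup v k"
        by (simp add: w(2) wf lookup_add lookup_coin_exp[OF X])
      consider "k = i" | "k = j" | "k \<noteq> i" "k \<noteq> j" by blast
      then show ?thesis
      proof cases
        case 1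
        then have "{x\<in>X. f' x = k} = C - Y" using ij by (auto simp: f'_def C_def)
        then show ?thesis using 1 Y(3) ij
          by (simp add: lookup_coin_exp[OF X] lookup_add lookup_minus lookup_single)
      next
        case 2
        then have "{x\<in>X. f' x = k} = Y \<union> {x\<in>X. f x = k}" "Y \<inter> {x\<in>X. f x = k} = {}"
          using Y(1) ij by (auto simp: f'_def C_def)
        moreover have "finite Y" using Y(1) X by (auto simp: C_def intro: finite_subset)
        ultimately have "sum e {x\<in>X. f' x = k} = sum e Y + sum e {x\<in>X. f x = k}"
          using X by (simp add: sum.union_disjoint)
        then show ?thesis using 2 Y(2) rest ij
          by (simp add: lookup_coin_exp[OF X] lookup_add lookup_minus lookup_single)
      next
        case 3
        then have "{x\<in>X. f' x = k} = {x\<in>X. f x = k}"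
          using Y(1) by (auto simp: f'_def C_def)
        then show ?thesis using 3 rest
          by (simp add: lookup_coin_exp[OF X] lookup_add lookup_minus lookup_single)
      qed
    qed
    from le_imp_add[OF this] w'
    have "\<exists>w\<in>?V. \<exists>r. ?v' = w + r" by blast
    moreover have "v - Poly_Mapping.single i t \<in> exps_in n"
      using v by (auto simp: exps_in_def in_keys_iff lookup_minus subset_eq)
    then have "?v' \<in> exps_in n"
      using ij by (intro exps_in_add exps_in_single) auto
    ultimately show ?thesis by blast
  qed
  show ?thesis
    unfolding e_def[symmetric] d_fixed_def
  proof (intro conjI allI impI)
    show "monomial_ideal n (mon_ideal n ?V :: 'k poly set)"
      by (rule monomial_ideal_mon_ideal[OF V])
  next
    fix v i j t
    assume vt: "(monomial v :: 'k poly) \<in> mon_ideal n ?V \<and> 1 \<le> j \<and> j < i \<and> i \<le> n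
      \<and> d_le d s t (Poly_Mapping.lookup v i)"
    then obtain w r where "v \<in> exps_in n" "w \<in> ?V" "v = w + r"
      unfolding monomial_mem_mon_ideal_iff[OF V] by blast
    from move[OF this] vt
    show "(monomial (v - Poly_Mapping.single i t + Poly_Mapping.single j t) :: 'k poly)
        \<in> mon_ideal n ?V"
      unfolding monomial_mem_mon_ideal_iff[OF V] by simp
  qed
qed

text \<open>Conversely, start with every coin at its bound. If at each position the numbers of coins
  of the various levels are digits of a \<open>d\<close>-decomposition, every placement is reached by
  moving one coin at a time: when the coins are taken in increasing order of their bounds, no
  moved coin lies beyond the position of a coin still to be moved, so the coins found at the
  current position all started there.\<close>

lemma d_fixed_mem_placements:
  fixes lev b :: "'x \<Rightarrow> nat"
  assumes d: "d_sequence d s" and X: "finite X" and lev: "lev ` X \<subseteq> {..s}" and b: "b ` X \<subseteq> {1..n}"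
    and digit: "\<And>p t. t < s \<Longrightarrow> card {x\<in>X. b x = p \<and> lev x = t} < d (Suc t) div d t"
    and I: "d_fixed n d s (I :: ('k::field) poly set)"
    and start: "monomial (coin_exp X (\<lambda>x. d (lev x)) b) \<in> I"
    and v: "v \<in> placements X (\<lambda>x. d (lev x)) b"
  shows "monomial v \<in> I"
proof -
  define e where "e = (\<lambda>x. d (lev x))"
  obtain g where g: "\<And>x. x \<in> X \<Longrightarrow> g x \<in> {1..b x}" and v: "v = coin_exp X e g"
    using v unfolding placements_eq[OF X] e_def by blast
  define F where "F = (\<lambda>Y x. if x \<in> Y then g x else b x)"
  have "monomial (coin_exp X e (F Y)) \<in> I" if "Y \<subseteq> X" for Y
    using finite_subset[OF that X] that
  proof (induction Y rule: finite_ranking_induct[where f = b])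
    case empty
    then show ?case using start by (simp add: F_def e_def)
  next
    case (insert x Y)
    have x: "x \<in> X" and IH: "monomial (coin_exp X e (F Y)) \<in> I" using insert by auto
    let ?F = "F (insert x Y)"
    show ?case
    proof (cases "x \<in> Y \<or> g x = b x")
      case True
      then have "?F = F Y" by (auto simp: F_def fun_eq_iff)
      then show ?thesis using IH by simp
    next
      case False
      define C where "C = {y\<in>X. F Y y = b x}"
      have C: "finite C" "x \<in> C" using X x False by (auto simp: C_def F_def)
      \<comment> \<open>A moved coin lies at most at its bound, which does not exceed \<open>b x\<close>.\<close>
      have home: "b y = b x" if "y \<in> C" for y
      proof (cases "y \<in> Y")
        case True
        then show ?thesis
          using that g[of y] insert.hyps(2)[OF True] by (auto simp: C_def F_def)
      qed (use that in \<open>auto simp: C_def F_def\<close>)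
      have le: "d_le d s (e x) (Poly_Mapping.lookup (coin_exp X e (F Y)) (b x))"
      proof -
        define num where "num = (\<lambda>t. card {y\<in>C. lev y = t})"
        define one where "one = (\<lambda>t. if t = lev x then 1 else 0 :: nat)"
        have "sum e C = (\<Sum>t\<le>s. sum e {y\<in>C. lev y = t})"
          using C lev by (intro sum.group[symmetric]) (auto simp: C_def)
        also have "\<dots> = (\<Sum>t\<le>s. num t * d t)"
          by (intro sum.cong) (simp_all add: num_def e_def)
        finally have "Poly_Mapping.lookup (coin_exp X e (F Y)) (b x) = (\<Sum>t\<le>s. num t * d t)"
          by (simp add: lookup_coin_exp[OF X] C_def)
        moreover have num: "num t < d (Suc t) div d t" if "t < s" for t
        proof -
          have "num t \<le> card {y\<in>X. b y = b x \<and> lev y = t}"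
            unfolding num_def using X home by (intro card_mono) (auto simp: C_def)
          then show ?thesis using digit[OF that, of "b x"] by simp
        qed
        ultimately have "d_decomposition d s
            (Poly_Mapping.lookup (coin_exp X e (F Y)) (b x)) num"
          by (simp add: d_decomposition_def)
        moreover have le: "one t \<le> num t" for t
        proof (cases "t = lev x")
          case True
          then have "{y\<in>C. lev y = t} \<noteq> {}" using C by blast
          then show ?thesis using True C(1) by (simp add: one_def num_def Suc_le_eq card_gt_0_iff)
        qed (simp add: one_def)
        moreover have "e x = (\<Sum>t\<le>s. one t * d t)"
        proof -
          have "(\<Sum>t\<le>s. one t * d t) = (\<Sum>t\<le>s. if t = lev x then d t else 0)"
            by (intro sum.cong) (auto simp: one_def)
          then show ?thesis using lev x by (auto simp: e_def)
        qed
        then have "d_decomposition d s (e x) one"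
          using num le by (auto simp: d_decomposition_def intro: le_less_trans)
        ultimately show ?thesis unfolding d_le_def by blast
      qed
      have "1 \<le> g x" "g x < b x" "b x \<le> n"
        using False g[OF x] b x by auto
      with I IH le have "monomial (coin_exp X e (F Y) - Poly_Mapping.single (b x) (e x)
          + Poly_Mapping.single (g x) (e x)) \<in> I"
        unfolding d_fixed_def by blast
      moreover have "coin_exp X e (F Y)
          = Poly_Mapping.single (b x) (e x) + coin_exp (X - {x}) e (F Y)"
        using False unfolding coin_exp_def sum.remove[OF X x] by (simp add: F_def)
      moreover have "coin_exp X e ?F
          = coin_exp (X - {x}) e (F Y) + Poly_Mapping.single (g x) (e x)"
      proof -
        have "coin_exp (X - {x}) e ?F = coin_exp (X - {x}) e (F Y)"
          unfolding coin_exp_def by (intro sum.cong) (auto simp: F_def)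
        moreover have "coin_exp X e ?F
            = Poly_Mapping.single (g x) (e x) + coin_exp (X - {x}) e ?F"
          unfolding coin_exp_def sum.remove[OF X x] by (simp add: F_def)
        ultimately show ?thesis by (simp add: add.commute)
      qed
      ultimately show ?thesis by simp
    qed
  qed
  from this[of X] have "monomial (coin_exp X e (F X)) \<in> I" by simp
  moreover have "coin_exp X e (F X) = v"
    unfolding v coin_exp_def by (intro sum.cong) (auto simp: F_def)
  ultimately show ?thesis by simp
qed

lemma d_fixed_closure_coin_exp:
  fixes lev b :: "'x \<Rightarrow> nat"
  assumes d: "d_sequence d s" and X: "finite X" and lev: "lev ` X \<subseteq> {..s}" and b: "b ` X \<subseteq> {1..n}"
    and digit: "\<And>p t. t < s \<Longrightarrow> card {x\<in>X. b x = p \<and> lev x = t} < d (Suc t) div d t"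
  shows "d_fixed_closure n d s (monomial (coin_exp X (\<lambda>x. d (lev x)) b))
           = (mon_ideal n (placements X (\<lambda>x. d (lev x)) b) :: ('k::field) poly set)"
    (is "d_fixed_closure n d s ?u = mon_ideal n ?V")
proof
  let ?R = "poly_ring n :: 'k poly ring"
  interpret R: cring ?R by (rule cring_poly_ring)
  have V: "?V \<subseteq> exps_in n" by (rule placements_exps_in[OF X b])
  have "coin_exp X (\<lambda>x. d (lev x)) b \<in> ?V"
    unfolding placements_eq[OF X] using b by (intro imageI) auto
  then have u: "?u \<in> mon_ideal n ?V"
    using monomial_mem_mon_ideal[OF V, of _ 0] V by auto
  then have uc: "?u \<in> carrier ?R" by (simp add: mon_ideal_eq[OF V])
  show "d_fixed_closure n d s ?u \<subseteq> mon_ideal n ?V"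
    using d_fixed_closure_least(3)[OF uc d_fixed_placements[OF d X lev b] u] .
  have fixed: "d_fixed n d s (d_fixed_closure n d s ?u)"
    by (rule d_fixed_closure_least(1)[OF uc])
  then have "monomial ` ?V \<subseteq> d_fixed_closure n d s ?u"
    using d_fixed_mem_placements[OF d X lev b digit] d_fixed_closure_least(2)[OF uc] by blast
  moreover have "ideal (d_fixed_closure n d s ?u) ?R"
    using fixed by (simp add: d_fixed_def monomial_ideal_iff)
  ultimately show "mon_ideal n ?V \<subseteq> d_fixed_closure n d s ?u"
    unfolding mon_ideal_def by (intro R.genideal_minimal)
qed

section \<open>The product formula\<close>

text \<open>The product over a finite set \<open>Q\<close> of piles. The exponent \<open>\<alpha> q\<close>, lying at position \<open>i q\<close>, is
  paid with \<open>c q t\<close> coins \<open>(q, t, k)\<close> of value \<open>d t\<close> for each level \<open>t\<close>; as the positions of the piles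
  differ, the numbers of coins at each position are the digits of a single \<open>\<alpha> q\<close>.\<close>

lemma d_fixed_closure_prod:
  fixes Q :: "'q set"
  assumes d: "d_sequence d s" and Q: "finite Q" and inj: "inj_on i Q" and i: "i ` Q \<subseteq> {1..n}"
    and c: "\<And>q. q \<in> Q \<Longrightarrow> d_decomposition d s (\<alpha> q) (c q)"
  shows "d_fixed_closure n d s (\<Prod>q\<in>Q. indet (i q) ^ \<alpha> q :: ('k::field) poly)
           = (\<Otimes>\<^bsub>ideals_set (poly_ring n)\<^esub> q\<in>Q. \<Otimes>\<^bsub>ideals_set (poly_ring n)\<^esub> t\<in>{0..s}.
                frob_power_ideal n (i q) (d t) [^]\<^bsub>ideals_set (poly_ring n)\<^esub> c q t)"
proof -
  define X where "X = Sigma Q (\<lambda>q. Sigma {0..s} (\<lambda>t. {..<c q t}))"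
  define lev :: "'q \<times> nat \<times> nat \<Rightarrow> nat" where "lev = (\<lambda>(q, t, k). t)"
  define b :: "'q \<times> nat \<times> nat \<Rightarrow> nat" where "b = (\<lambda>(q, t, k). i q)"
  define V where "V = (\<lambda>q t. (\<lambda>j. Poly_Mapping.single j (d t)) ` {1..i q})"
  have X: "finite X" using Q by (auto simp: X_def)
  have lev: "lev ` X \<subseteq> {..s}" by (auto simp: X_def lev_def)
  have b: "b ` X \<subseteq> {1..n}" using i by (auto simp: X_def b_def)
  have digit: "card {x\<in>X. b x = p \<and> lev x = t} < d (Suc t) div d t" if t: "t < s" for p t
  proof (cases "p \<in> i ` Q")
    case True
    then obtain q where q: "q \<in> Q" "p = i q" by blast
    then have "{x\<in>X. b x = p \<and> lev x = t} = (\<lambda>k. (q, t, k)) ` {..<c q t}"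
      using t inj by (auto simp: X_def b_def lev_def inj_on_eq_iff)
    then have "card {x\<in>X. b x = p \<and> lev x = t} = c q t"
      by (simp add: card_image inj_on_def)
    then show ?thesis using c[OF q(1)] t by (simp add: d_decomposition_def)
  next
    case False
    then have "{x\<in>X. b x = p \<and> lev x = t} = {}" by (auto simp: X_def b_def)
    moreover have "0 < d (Suc t) div d t"
      using d t d_sequence_pos[OF d, of t]
      by (auto simp: d_sequence_def div_greater_zero_iff intro: less_imp_le)
    ultimately show ?thesis by (simp only: card.empty)
  qed
  have single_sum: "Poly_Mapping.single k (sum h A) = (\<Sum>x\<in>A. Poly_Mapping.single k (h x))"
    if "finite A" for k :: nat and h :: "nat \<Rightarrow> nat" and A
    using that by (induction A rule: finite_induct) (simp_all add: single_add)
  have flatten: "sum (\<lambda>x. h (b x) (lev x)) X = (\<Sum>q\<in>Q. \<Sum>t\<in>{0..s}. \<Sum>k<c q t. h (i q) t)"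
    for h :: "nat \<Rightarrow> nat \<Rightarrow> 'z::comm_monoid_add"
    unfolding X_def using Q
    by (simp add: sum.Sigma lev_def b_def case_prod_unfold del: sum_constant)
  have "coin_exp X (\<lambda>x. d (lev x)) b
      = (\<Sum>q\<in>Q. \<Sum>t\<in>{0..s}. \<Sum>k<c q t. Poly_Mapping.single (i q) (d t))"
    unfolding coin_exp_def by (rule flatten)
  also have "\<dots> = (\<Sum>q\<in>Q. Poly_Mapping.single (i q) (\<alpha> q))"
  proof (intro sum.cong refl)
    fix q assume "q \<in> Q"
    then have "\<alpha> q = (\<Sum>t\<in>{0..s}. \<Sum>k<c q t. d t)"
      using c by (simp add: d_decomposition_def atMost_atLeast0)
    then show "(\<Sum>t\<in>{0..s}. \<Sum>k<c q t. Poly_Mapping.single (i q) (d t))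
        = Poly_Mapping.single (i q) (\<alpha> q)"
      by (simp only: single_sum finite_atLeastAtMost finite_lessThan)
  qed
  finally have "d_fixed_closure n d s (\<Prod>q\<in>Q. indet (i q) ^ \<alpha> q :: 'k poly)
      = d_fixed_closure n d s (monomial (coin_exp X (\<lambda>x. d (lev x)) b))"
    using Q by (simp add: monomial_sum indet_power)
  also have "\<dots> = mon_ideal n (placements X (\<lambda>x. d (lev x)) b)"
    by (rule d_fixed_closure_coin_exp[OF d X lev b digit])
  also have "placements X (\<lambda>x. d (lev x)) b = (\<Sum>q\<in>Q. \<Sum>t\<in>{0..s}. \<Sum>k<c q t. V q t)"
    unfolding placements_def V_def
    by (rule flatten[of "\<lambda>p t. (\<lambda>j. Poly_Mapping.single j (d t)) ` {1..p}"])
  also have "mon_ideal n \<dots> = (\<Otimes>\<^bsub>ideals_set (poly_ring n)\<^esub> q\<in>Q. mon_ideal n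
      (\<Sum>t\<in>{0..s}. \<Sum>k<c q t. V q t))"
    using Q i
    by (intro mon_ideal_finprod[symmetric] exps_in_set_sum)
      (auto simp: V_def intro!: exps_in_single)
  finally have closure: "d_fixed_closure n d s (\<Prod>q\<in>Q. indet (i q) ^ \<alpha> q :: 'k poly)
      = (\<Otimes>\<^bsub>ideals_set (poly_ring n)\<^esub> q\<in>Q. mon_ideal n (\<Sum>t\<in>{0..s}. \<Sum>k<c q t. V q t))" .
  let ?R = "poly_ring n :: 'k poly ring"
  interpret R: cring ?R by (rule cring_poly_ring)
  interpret M: comm_monoid "ideals_set ?R" by (rule R.ideals_set_is_comm_monoid)
  have factor: "mon_ideal n (\<Sum>t\<in>{0..s}. \<Sum>k<c q t. V q t)
      = (\<Otimes>\<^bsub>ideals_set ?R\<^esub> t\<in>{0..s}. frob_power_ideal n (i q) (d t) [^]\<^bsub>ideals_set ?R\<^esub> c q t)"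
    if "q \<in> Q" for q
    unfolding V_def using i that by (intro frob_power_ideal_product[symmetric]) auto
  have "mon_ideal n (\<Sum>t\<in>{0..s}. \<Sum>k<c q t. V q t) \<in> carrier (ideals_set ?R)"
    if "q \<in> Q" for q
  proof -
    have "(\<Sum>t\<in>{0..s}. \<Sum>k<c q t. V q t) \<subseteq> exps_in n"
      using i that by (intro exps_in_set_sum) (auto simp: V_def intro!: exps_in_single)
    then show ?thesis using mon_ideal_ideal by (simp add: ideals_set_def)
  qed
  then show ?thesis
    unfolding closure using factor by (intro M.finprod_cong') auto
qed

theorem proposition1p4p11:
  fixes n s r :: nat
    and d i \<alpha> :: "nat \<Rightarrow> nat"
    and c :: "nat \<Rightarrow> nat \<Rightarrow> nat"
    and u :: "('k::field) poly"
  assumes "d_sequence d s"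
    and "1 \<le> r" and "1 \<le> i 1" and "strict_mono_on {1..r} i" and "i r = n"
    and "\<And>q. q \<in> {1..r} \<Longrightarrow> 0 < \<alpha> q"
    and "\<And>q. q \<in> {1..r} \<Longrightarrow> d_decomposition d s (\<alpha> q) (c q)"
    and "u = (\<Prod>q\<in>{1..r}. indet (i q) ^ \<alpha> q)"
  shows "d_fixed_closure n d s u =
           (\<Otimes>\<^bsub>ideals_set (poly_ring n)\<^esub> q\<in>{1..r}. d_fixed_closure n d s (indet (i q) ^ \<alpha> q))
       \<and> (\<Otimes>\<^bsub>ideals_set (poly_ring n)\<^esub> q\<in>{1..r}. d_fixed_closure n d s (indet (i q) ^ \<alpha> q :: 'k poly)) =
           (\<Otimes>\<^bsub>ideals_set (poly_ring n)\<^esub> q\<in>{1..r}. \<Otimes>\<^bsub>ideals_set (poly_ring n)\<^esub> t\<in>{0..s}.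
              frob_power_ideal n (i q) (d t) [^]\<^bsub>ideals_set (poly_ring n)\<^esub> c q t)"
proof -
  let ?R = "poly_ring n :: 'k poly ring"
  interpret R: cring ?R by (rule cring_poly_ring)
  interpret M: comm_monoid "ideals_set ?R" by (rule R.ideals_set_is_comm_monoid)
  define P where "P = (\<lambda>q. \<Otimes>\<^bsub>ideals_set ?R\<^esub> t\<in>{0..s}.
      frob_power_ideal n (i q) (d t) [^]\<^bsub>ideals_set ?R\<^esub> c q t)"
  have mono: "mono_on {1..r} i"
    using assms(4) by (rule strict_mono_on_imp_mono_on)
  have i: "i q \<in> {1..n}" if "q \<in> {1..r}" for q
    using mono_onD[OF mono, of 1 q] mono_onD[OF mono, of q r] that assms(3,5) by auto
  have P: "P q \<in> carrier (ideals_set ?R)" if "q \<in> {1..r}" for q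
  proof -
    have "(\<Sum>t\<in>{0..s}. \<Sum>k<c q t. (\<lambda>j. Poly_Mapping.single j (d t)) ` {1..i q}) \<subseteq> exps_in n"
      using i[OF that] by (intro exps_in_set_sum) (auto intro!: exps_in_single)
    then show ?thesis
      using i[OF that] mon_ideal_ideal
      by (simp add: P_def frob_power_ideal_product) (simp add: ideals_set_def)
  qed
  have "d_fixed_closure n d s (indet (i q) ^ \<alpha> q) = P q" if "q \<in> {1..r}" for q
    using d_fixed_closure_prod[OF assms(1), of "{q}" i n \<alpha> c, where 'k = 'k]
      i[OF that] assms(7)[OF that] P[OF that]
    by (simp add: P_def[symmetric])
  then have single: "(\<Otimes>\<^bsub>ideals_set ?R\<^esub> q\<in>{1..r}. d_fixed_closure n d s (indet (i q) ^ \<alpha> q))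
      = (\<Otimes>\<^bsub>ideals_set ?R\<^esub> q\<in>{1..r}. P q)"
    using P by (intro M.finprod_cong') auto
  have "d_fixed_closure n d s u = (\<Otimes>\<^bsub>ideals_set ?R\<^esub> q\<in>{1..r}. P q)"
    unfolding assms(8) P_def
    using i assms(7) strict_mono_on_imp_inj_on[OF assms(4)]
    by (intro d_fixed_closure_prod[OF assms(1)]) auto
  with single show ?thesis by (simp add: P_def)
qed

end
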